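(* Let $m\geqslant 2$ and let $n$ be a positive integer. If $m\geqslant 3$, then the maximum of $b_m(\boldsymbol{\lambda})$ over all $m$-ary partitions $\boldsymbol{\lambda}$ of $n$ is attained at the partition consisting of $\lfloor n/m\rfloor$ parts equal to $m$ and $n-m\lfloor n/m\rfloor$ parts equal to $1$. If $m=2$, this maximum is attained at each of the partitions consisting of $i$ parts equal to $4$, $\lfloor n/2\rfloor-2i$ parts equal to $2$, and $n-2\lfloor n/2\rfloor$ parts equal to $1$, where $0\leqslant i\leqslant\lfloor n/4\rfloor$. In particular, for every $m\geqslant 2$, $$\max\{b_m(\boldsymbol{\lambda}):\boldsymbol{\lambda}\text{ an } m\text{-ary partition of } n\}=2^{\lfloor n/m\rfloor}.$$
   Context: For an integer $m\geqslant2$, an $m$-ary partition of $n$ is a partition of $n$ all of whose parts belong to $\{1,m,m^2,\ldots\}$, and $b_m(n)$ is the number of $m$-ary partitions of $n$. The extended $m$-ary partition function is defined on an $m$-ary partition $\boldsymbol{\lambda}=(\lambda_1,\ldots,\lambda_j)$ by $b_m(\boldsymbol{\lambda})=\prod_{i=1}^j b_m(\lambda_i)$. *)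

theory Defs
  imports "HOL-Library.Multiset"
begin

text \<open>A partition of \<open>n\<close> is represented by the multiset of its parts.\<close>

definition is_partition :: "nat \<Rightarrow> nat multiset \<Rightarrow> bool" where
  "is_partition n P \<longleftrightarrow> (\<forall>p \<in># P. p > 0) \<and> sum_mset P = n"

definition is_mary_partition :: "nat \<Rightarrow> nat \<Rightarrow> nat multiset \<Rightarrow> bool" where
  "is_mary_partition m n P \<longleftrightarrow> is_partition n P \<and> (\<forall>p \<in># P. \<exists>k. p = m ^ k)"

definition mary :: "nat \<Rightarrow> nat \<Rightarrow> nat" where
  "mary m n = card {P. is_mary_partition m n P}"

definition mary_ext :: "nat \<Rightarrow> nat multiset \<Rightarrow> nat" where
  "mary_ext m P = (\<Prod>p \<in># P. mary m p)"

end

theory Submission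
  imports Defs
begin

text \<open>
  Splitting off \<open>m\<close> parts equal to 1 when there are that many, and dividing all parts other
  than 1 by \<open>m\<close> when there are not, gives \<open>b\<^sub>m(n) \<le> b\<^sub>m(n - m) + b\<^sub>m(\<lfloor>n/m\<rfloor>)\<close> for \<open>n \<ge> m\<close>, and
  hence \<open>b\<^sub>m(n) \<le> 2 ^ \<lfloor>n/m\<rfloor>\<close> for all \<open>n\<close> by induction. Superadditivity of \<open>n \<mapsto> \<lfloor>n/m\<rfloor>\<close> turns
  this into the bound \<open>2 ^ \<lfloor>n/m\<rfloor>\<close> for the extended function. The bound is attained because
  \<open>b\<^sub>m(1) = 1\<close>, \<open>b\<^sub>m(m) = 2\<close> and \<open>b\<^sub>2(4) = 4\<close>.
\<close>

section \<open>Finiteness of the set of partitions of \<open>n\<close>\<close>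

lemma size_le_sum_mset:
  fixes P :: "nat multiset"
  assumes "\<forall>p \<in># P. p > 0"
  shows "size P \<le> sum_mset P"
  using assms by (induction P) auto

text \<open>Positive parts with sum \<open>n\<close> number at most \<open>n\<close> and are each at
  most \<open>n\<close>, so lists of bounded length over \<open>{..n}\<close> cover all partitions.
  Finiteness gives \<open>card\<close> and \<open>Max\<close> their intended meaning.\<close>

lemma finite_is_partition: "finite {P. is_partition n P}"
proof (rule finite_subset)
  show "{P. is_partition n P} \<subseteq> mset ` {xs. set xs \<subseteq> {..n} \<and> length xs \<le> n}"
  proof
    fix P assume "P \<in> {P. is_partition n P}"
    then have pos: "\<forall>p \<in># P. p > 0" and sum: "sum_mset P = n"
      by (auto simp: is_partition_def)
    obtain xs where xs: "P = mset xs" by (metis ex_mset)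
    have "x \<le> n" if "x \<in> set xs" for x
      using member_le_sum_list[OF that] sum by (simp add: xs sum_mset_sum_list)
    moreover have "length xs \<le> n"
      using size_le_sum_mset[OF pos] sum by (simp add: xs)
    ultimately show "P \<in> mset ` {xs. set xs \<subseteq> {..n} \<and> length xs \<le> n}"
      using xs by auto
  qed
  show "finite (mset ` {xs. set xs \<subseteq> {..n} \<and> length xs \<le> n})"
    by (intro finite_imageI finite_lists_length_le) simp
qed

lemma finite_is_mary_partition: "finite {P. is_mary_partition m n P}"
  by (rule finite_subset[OF _ finite_is_partition[of n]]) (auto simp: is_mary_partition_def)

lemma card_le_mary:
  assumes "\<And>P. P \<in> A \<Longrightarrow> is_mary_partition m n P"
  shows "card A \<le> mary m n"
  unfolding mary_def by (rule card_mono[OF finite_is_mary_partition]) (use assms in auto)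

lemma is_mary_partition_add:
  "is_mary_partition m a P \<Longrightarrow> is_mary_partition m b Q \<Longrightarrow> is_mary_partition m (a + b) (P + Q)"
  unfolding is_mary_partition_def is_partition_def by auto

text \<open>Every explicit partition below is assembled from such blocks of equal parts, with
  \<open>k\<close> = 0, 1, 2 giving the parts 1, \<open>m\<close> and \<open>m ^ 2\<close>.\<close>

lemma is_mary_partition_replicate:
  "m > 0 \<Longrightarrow> is_mary_partition m (j * m ^ k) (replicate_mset j (m ^ k))"
  unfolding is_mary_partition_def is_partition_def by (auto split: if_splits)

lemma mary_0: "mary m 0 = 1"
proof -
  have "{P. is_mary_partition m 0 P} = {{#}}"
    by (auto simp: is_mary_partition_def is_partition_def)
       (metis ex_in_conv less_numeral_extra(3) set_mset_eq_empty_iff)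
  then show ?thesis by (simp add: mary_def)
qed

lemma sum_mset_div_le: "(\<Sum>p \<in># P. p div m) \<le> sum_mset P div (m::nat)"
proof (induction P)
  case (add x P)
  have "x div m + sum_mset P div m \<le> (x + sum_mset P) div m"
    using div_add1_eq[of x "sum_mset P" m] by linarith
  with add show ?case by simp
qed simp

section \<open>The recurrence and the exponential bound\<close>

lemma mary_partitions_few_ones:
  assumes "m \<ge> 2"
  shows "{P. is_mary_partition m n P \<and> count P 1 < m}
    \<subseteq> (\<lambda>Q. image_mset ((*) m) Q + replicate_mset (n mod m) 1) ` {Q. is_mary_partition m (n div m) Q}"
proof
  fix P assume "P \<in> {P. is_mary_partition m n P \<and> count P 1 < m}"
  then have sum: "sum_mset P = n" and pow: "\<And>p. p \<in># P \<Longrightarrow> \<exists>k. p = m ^ k"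
    and few: "count P 1 < m"
    by (auto simp: is_mary_partition_def is_partition_def)
  define R where "R = filter_mset (\<lambda>p. p \<noteq> 1) P"
  define Q where "Q = image_mset (\<lambda>p. p div m) R"
  \<comment> \<open>A power of \<open>m\<close> other than 1 has a positive exponent, so
    \<open>m\<close> divides it and the quotient is again a power of \<open>m\<close>.\<close>
  have powR: "\<exists>k. p = m * m ^ k" if p: "p \<in># R" for p
  proof -
    obtain k where "p = m ^ k" using p pow by (auto simp: R_def)
    moreover have "p \<noteq> 1" using p by (auto simp: R_def)
    ultimately show ?thesis by (cases k) auto
  qed
  have Q: "\<exists>k. q = m ^ k" if "q \<in># Q" for q
    using that powR assms by (fastforce simp: Q_def)
  have R: "R = image_mset ((*) m) Q"
  proof -
    have "image_mset (\<lambda>p. m * (p div m)) R = image_mset (\<lambda>p. p) R"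
      by (rule image_mset_cong) (use powR assms in fastforce)
    then show ?thesis by (simp add: Q_def multiset.map_comp comp_def)
  qed
  have P: "P = R + replicate_mset (count P 1) 1"
    unfolding R_def by (rule multiset_eqI) auto
  have sumR: "sum_mset R = m * sum_mset Q"
    using sum_mset_distrib_left[of m "\<lambda>x. x" Q] by (simp add: R)
  have n: "n = m * sum_mset Q + count P 1"
    using arg_cong[OF P, of sum_mset] by (simp add: sum sumR)
  \<comment> \<open>Fewer than \<open>m\<close> ones remain beside a multiple of \<open>m\<close>,
    so their number is the remainder. Thus \<open>n\<close> and \<open>Q\<close> determine
    \<open>P\<close>.\<close>
  have "n div m = sum_mset Q" "n mod m = count P 1"
    using few by (simp_all add: n)
  moreover have "is_mary_partition m (sum_mset Q) Q"
    unfolding is_mary_partition_def is_partition_def using Q assms by fastforce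
  ultimately show "P \<in> (\<lambda>Q. image_mset ((*) m) Q + replicate_mset (n mod m) 1) `
      {Q. is_mary_partition m (n div m) Q}"
    using P R by auto
qed

lemma mary_partitions_many_ones:
  "{P. is_mary_partition m n P \<and> m \<le> count P 1}
    \<subseteq> (\<lambda>Q. Q + replicate_mset m 1) ` {Q. is_mary_partition m (n - m) Q}"
proof
  fix P assume "P \<in> {P. is_mary_partition m n P \<and> m \<le> count P 1}"
  then have part: "is_mary_partition m n P" and many: "m \<le> count P 1" by auto
  define Q where "Q = P - replicate_mset m 1"
  have P: "P = Q + replicate_mset m 1"
    using many by (simp add: Q_def count_le_replicate_mset_subset_eq)
  have "is_mary_partition m (n - m) Q"
    using part unfolding P is_mary_partition_def is_partition_def by auto
  with P show "P \<in> (\<lambda>Q. Q + replicate_mset m 1) ` {Q. is_mary_partition m (n - m) Q}"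
    by auto
qed

lemma card_few_ones:
  assumes "m \<ge> 2"
  shows "card {P. is_mary_partition m n P \<and> count P 1 < m} \<le> mary m (n div m)"
  unfolding mary_def
  by (rule surj_card_le[OF finite_is_mary_partition mary_partitions_few_ones[OF assms]])

lemma card_many_ones: "card {P. is_mary_partition m n P \<and> m \<le> count P 1} \<le> mary m (n - m)"
  unfolding mary_def by (rule surj_card_le[OF finite_is_mary_partition mary_partitions_many_ones])

lemma mary_le_add:
  assumes "m \<ge> 2"
  shows "mary m n \<le> mary m (n - m) + mary m (n div m)"
proof -
  have "{P. is_mary_partition m n P} =
      {P. is_mary_partition m n P \<and> m \<le> count P 1} \<union> {P. is_mary_partition m n P \<and> count P 1 < m}"
    by auto
  then have "mary m n \<le> card {P. is_mary_partition m n P \<and> m \<le> count P 1}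
      + card {P. is_mary_partition m n P \<and> count P 1 < m}"
    unfolding mary_def by (metis card_Un_le)
  with card_few_ones[OF assms, of n] card_many_ones[of m n] show ?thesis by linarith
qed

text \<open>For \<open>n < m\<close> truncated subtraction turns \<open>mary_le_add\<close> into the
  bound \<open>mary m 0 + mary m 0 = 2\<close>, too weak to start the induction. Here no partition
  has \<open>m\<close> ones, so one of the two summands disappears.\<close>

lemma mary_le_1:
  assumes "m \<ge> 2" "n < m"
  shows "mary m n \<le> 1"
proof -
  have "count P 1 < m" if "is_mary_partition m n P" for P
  proof -
    have "count P 1 \<le> size P" by (rule count_le_size)
    also have "\<dots> \<le> n"
      using size_le_sum_mset[of P] that by (auto simp: is_mary_partition_def is_partition_def)
    finally show ?thesis using assms by simp
  qed
  then have "{P. is_mary_partition m n P} = {P. is_mary_partition m n P \<and> count P 1 < m}"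
    by auto
  then have "mary m n \<le> mary m (n div m)"
    using card_few_ones[OF assms(1), of n] by (simp add: mary_def)
  with assms show ?thesis by (simp add: mary_0)
qed

lemma mary_le_power:
  assumes "m \<ge> 2"
  shows "mary m n \<le> 2 ^ (n div m)"
proof (induction n rule: less_induct)
  case (less n)
  show ?case
  proof (cases "n < m")
    case True
    with mary_le_1[OF assms True] show ?thesis by simp
  next
    case False
    define q where "q = n div m"
    have q: "q > 0" using False assms by (simp add: q_def div_greater_zero_iff)
    have "mary m (n - m) \<le> 2 ^ (q - 1)"
      using less[of "n - m"] False assms by (simp add: q_def div_if[of n m])
    moreover have "mary m q \<le> 2 ^ (q div m)"
      unfolding q_def by (rule less.IH) (use False assms in simp)
    \<comment> \<open>Since \<open>m \<ge> 2\<close> and \<open>q > 0\<close>, division by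
      \<open>m\<close> lowers \<open>q\<close> by at least 1. Both summands of the recurrence are
      then at most \<open>2 ^ (q - 1)\<close>, and together at most \<open>2 ^ q\<close>.\<close>
    moreover have "(2::nat) ^ (q div m) \<le> 2 ^ (q - 1)"
    proof (rule power_increasing)
      have "q div m < q" using q assms by simp
      then show "q div m \<le> q - 1" by simp
    qed simp
    moreover have "(2::nat) ^ (q - 1) + 2 ^ (q - 1) = 2 ^ q"
      using q by (cases q) auto
    ultimately show ?thesis
      using mary_le_add[OF assms, of n] unfolding q_def by linarith
  qed
qed

section \<open>Exact values at 1, \<open>m\<close> and 4\<close>

lemma mary_1:
  assumes "m \<ge> 2"
  shows "mary m 1 = 1"
proof (rule antisym)
  show "mary m 1 \<le> 1" using mary_le_power[OF assms, of 1] assms by simp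
  have "is_mary_partition m 1 {#1#}"
    using is_mary_partition_replicate[of m 1 0] assms by simp
  then show "1 \<le> mary m 1" using card_le_mary[of "{{#1#}}" m 1] by auto
qed

lemma mary_self:
  assumes "m \<ge> 2"
  shows "mary m m = 2"
proof (rule antisym)
  show "mary m m \<le> 2" using mary_le_power[OF assms, of m] assms by simp
  have "is_mary_partition m m {#m#}" "is_mary_partition m m (replicate_mset m 1)"
    using is_mary_partition_replicate[of m 1 1] is_mary_partition_replicate[of m m 0] assms
    by simp_all
  then have "card {{#m#}, replicate_mset m 1} \<le> mary m m" by (intro card_le_mary) auto
  moreover have "{#m#} \<noteq> replicate_mset m 1"
    using assms by (auto dest: arg_cong[where f = size])
  ultimately show "2 \<le> mary m m" by simp
qed

text \<open>This value equals \<open>mary 2 2 ^ 2\<close>, so trading two parts 2 for one part 4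
  costs nothing; hence the whole family of maximal partitions for \<open>m = 2\<close>.\<close>

lemma mary_2_4: "mary 2 4 = 4"
proof (rule antisym)
  show "mary 2 4 \<le> 4" using mary_le_power[of 2 4] by simp
  let ?A = "{{#4#}, {#2, 2#}, {#2, 1, 1#}, {#1, 1, 1, 1#}} :: nat multiset set"
  have part: "is_mary_partition 2 (a * 4 + b * 2 + c)
      (replicate_mset a 4 + replicate_mset b 2 + replicate_mset c 1)" for a b c
    using is_mary_partition_replicate[of 2 a 2] is_mary_partition_replicate[of 2 b 1]
      is_mary_partition_replicate[of 2 c 0]
    by (auto intro!: is_mary_partition_add)
  have "card ?A \<le> mary 2 4"
    using part[of 1 0 0] part[of 0 2 0] part[of 0 1 2] part[of 0 0 4]
    by (intro card_le_mary) (auto simp: numeral_eq_Suc add_mset_commute)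
  \<comment> \<open>The four partitions are told apart by their sizes 1, 2, 3, 4.\<close>
  moreover have "4 \<le> card ?A"
    using card_image_le[of ?A size] by (simp add: numeral_eq_Suc)
  ultimately show "4 \<le> mary 2 4" by simp
qed

section \<open>The extended function and its maximizers\<close>

lemma mary_ext_le:
  assumes "m \<ge> 2" "is_mary_partition m n P"
  shows "mary_ext m P \<le> 2 ^ (n div m)"
proof -
  have "mary_ext m P \<le> 2 ^ (\<Sum>p \<in># P. p div m)"
    unfolding mary_ext_def
  proof (induction P)
    case (add x P)
    with mary_le_power[OF assms(1), of x] show ?case
      by (auto simp: power_add intro: mult_le_mono)
  qed simp
  also have "\<dots> \<le> 2 ^ (n div m)"
    using sum_mset_div_le[of m P] assms(2)
    by (intro power_increasing) (auto simp: is_mary_partition_def is_partition_def)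
  finally show ?thesis .
qed

text \<open>The bound \<open>2 ^ (n div m)\<close> depends only on \<open>n\<close> and
  \<open>m\<close>, so any partition of \<open>n\<close> reaching it is maximal.\<close>

lemma is_arg_max_mary_ext:
  assumes "m \<ge> 2" "is_mary_partition m n P" "mary_ext m P = 2 ^ (n div m)"
  shows "is_arg_max (mary_ext m) (is_mary_partition m n) P"
  using assms mary_ext_le[OF assms(1)] by (auto simp: is_arg_max_def not_less)

lemma mary_ext_union: "mary_ext m (P + Q) = mary_ext m P * mary_ext m Q"
  by (simp add: mary_ext_def)

lemma mary_ext_replicate: "mary_ext m (replicate_mset k p) = mary m p ^ k"
  by (simp add: mary_ext_def)

lemma maximal_partition:
  assumes "m \<ge> 2"
  defines "P \<equiv> \<lambda>n. replicate_mset (n div m) m + replicate_mset (n - m * (n div m)) 1"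
  shows "is_mary_partition m n (P n)" "mary_ext m (P n) = 2 ^ (n div m)"
proof -
  have "is_mary_partition m (n div m * m + (n - m * (n div m))) (P n)"
    unfolding P_def
    using is_mary_partition_replicate[of m "n div m" 1]
      is_mary_partition_replicate[of m "n - m * (n div m)" 0] assms(1)
    by (intro is_mary_partition_add) simp_all
  then show "is_mary_partition m n (P n)" by (simp add: mult.commute)
  show "mary_ext m (P n) = 2 ^ (n div m)"
    using assms(1) by (simp add: P_def mary_ext_union mary_ext_replicate mary_self mary_1[simplified])
qed

lemma maximal_binary_partition:
  assumes "i \<le> n div 4"
  defines "P \<equiv> replicate_mset i 4 + replicate_mset (n div 2 - 2 * i) 2
             + replicate_mset (n - 2 * (n div 2)) 1"
  shows "is_mary_partition 2 n P" "mary_ext 2 P = 2 ^ (n div 2)"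
proof -
  \<comment> \<open>This keeps the subtraction \<open>n div 2 - 2 * i\<close> from being truncated,
    both in the sum of the parts and in the exponent of 2.\<close>
  have i: "2 * i \<le> n div 2" using assms(1) by linarith
  have "is_mary_partition 2 (i * 4 + (n div 2 - 2 * i) * 2 + (n - 2 * (n div 2))) P"
    unfolding P_def
    using is_mary_partition_replicate[of 2 i 2] is_mary_partition_replicate[of 2 "n div 2 - 2 * i" 1]
      is_mary_partition_replicate[of 2 "n - 2 * (n div 2)" 0]
    by (intro is_mary_partition_add) simp_all
  moreover have "i * 4 + (n div 2 - 2 * i) * 2 + (n - 2 * (n div 2)) = n"
    using i by linarith
  ultimately show "is_mary_partition 2 n P" by metis
  have "mary_ext 2 P = 4 ^ i * 2 ^ (n div 2 - 2 * i)"
    by (simp add: P_def mary_ext_union mary_ext_replicate mary_self mary_1[simplified] mary_2_4)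
  also have "\<dots> = 2 ^ (2 * i + (n div 2 - 2 * i))"
    by (simp add: power_add power_mult)
  finally show "mary_ext 2 P = 2 ^ (n div 2)" using i by simp
qed

theorem theorem4p5:
  fixes m n :: nat
  assumes "m \<ge> 2" and "n > 0"
  shows
    "(m \<ge> 3 \<longrightarrow>
        is_arg_max (mary_ext m) (is_mary_partition m n)
          (replicate_mset (n div m) m + replicate_mset (n - m * (n div m)) 1))
     \<and> (m = 2 \<longrightarrow> (\<forall>i \<le> n div 4.
        is_arg_max (mary_ext m) (is_mary_partition m n)
          (replicate_mset i 4 + replicate_mset (n div 2 - 2 * i) 2
             + replicate_mset (n - 2 * (n div 2)) 1)))
     \<and> Max {mary_ext m P | P. is_mary_partition m n P} = 2 ^ (n div m)"
proof (intro conjI impI allI)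
  show "is_arg_max (mary_ext m) (is_mary_partition m n)
      (replicate_mset (n div m) m + replicate_mset (n - m * (n div m)) 1)"
    by (rule is_arg_max_mary_ext[OF assms(1) maximal_partition[OF assms(1)]])
next
  fix i assume "m = 2" "i \<le> n div 4"
  then show "is_arg_max (mary_ext m) (is_mary_partition m n)
      (replicate_mset i 4 + replicate_mset (n div 2 - 2 * i) 2 + replicate_mset (n - 2 * (n div 2)) 1)"
    using is_arg_max_mary_ext[OF _ maximal_binary_partition] by simp
next
  have "{mary_ext m P | P. is_mary_partition m n P} = mary_ext m ` {P. is_mary_partition m n P}"
    by auto
  then have "finite {mary_ext m P | P. is_mary_partition m n P}"
    using finite_is_mary_partition by simp
  then show "Max {mary_ext m P | P. is_mary_partition m n P} = 2 ^ (n div m)"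
  \<comment> \<open>The value bounds the set from above and, by \<open>maximal_partition\<close>,
    belongs to it.\<close>
  proof (rule Max_eqI)
    show "y \<le> 2 ^ (n div m)" if "y \<in> {mary_ext m P | P. is_mary_partition m n P}" for y
      using that mary_ext_le[OF assms(1)] by auto
    show "2 ^ (n div m) \<in> {mary_ext m P | P. is_mary_partition m n P}"
      using maximal_partition[OF assms(1), of n] by (metis (mono_tags, lifting) mem_Collect_eq)
  qed
qed

end
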